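(* Let $m\ge 1$, let $C\in\mathbb{R}^{3\times m}$, and let $A,B^t\in\mathcal{Q}_0(C)$ (so $A\in\mathbb{R}^{3\times m}$, $B\in\mathbb{R}^{m\times 3}$). Suppose the DSR graph $G_{A,B}$ satisfies: (i) every e-cycle of length $4$ in $G_{A,B}$ is an s-cycle; and (ii) every o-cycle of length $6$ in $G_{A,B}$ is an s-cycle. Then the DSR$^{[2]}$ graph $G^{[2]}_{A,B}$ is odd$^*$, $(AB)^{[2]}$ is a $P_0$-matrix, and no nonreal eigenvalue of $AB$ lies in the open left half-plane $\mathbb{C}_-$.
   Context: For $M\in\mathbb{R}^{n\times m}$, the qualitative class $\mathcal{Q}(M)$ is the set of all $X\in\mathbb{R}^{n\times m}$ with $\mathrm{sign}(X_{ij})=\mathrm{sign}(M_{ij})$ for all $i,j$; $\mathcal{Q}_0(M)$ denotes its closure. A square real matrix is a $P_0$-matrix if all its principal minors are nonnegative. For $M\in\mathbb{R}^{n\times n}$, $n\ge2$, the second additive compound $M^{[2]}$ is the $\binom n2\times\binom n2$ matrix of the linear map $u\wedge v\mapsto Mu\wedge v+u\wedge Mv$ on $\Lambda^2\mathbb{R}^n$ with respect to the basis $e_i\wedge e_j$ ($i<j$) in lexicographic order. DSR graphs: for $A\in\mathbb{R}^{n\times m}$, $B\in\mathbb{R}^{m\times n}$, $G_{A,B}$ is the signed, labelled bipartite digraph with S-vertices $S_1,\dots,S_n$ and R-vertices $R_1,\dots,R_m$, having an arc $R_j\to S_i$ of sign $\mathrm{sign}(A_{ij})$ iff $A_{ij}\ne0$,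 and an arc $S_i\to R_j$ of sign $\mathrm{sign}(B_{ji})$ iff $B_{ji}\neq 0$. A pair of antiparallel arcs between $S_i$ and $R_j$ with the same sign is regarded as a single undirected edge (traversable in either direction). An edge arising from $A_{ij}\ne0$ (R-to-S or undirected) has label $|A_{ij}|$; an edge with only S-to-R orientation has label $\infty$. A walk is an alternating sequence of vertices and edges, each edge traversed consistently with its orientation; vertices and edges may repeat; its length is the number of edges with multiplicity; it is closed if its first and last vertices coincide. The sign of a walk is the product of the signs of its edges (with multiplicity). A cycle is a nonempty closed walk repeating no vertex except first$=$last (so a 2-cycle needs two distinct edges between the same pair of vertices). Closed walks have even length; the parity of a walk $W$ of even length is $P(W)=(-1)^{|W|/2}\mathrm{sign}(W)$; a cycle is an e-cycle if $P=1$ and an o-cycle if $P=-1$. A closed walk $(e_1,\dots,e_{2r})$ is an s-walk if all its labels are finite and $\prod_{i=1}^r l(e_{2i-1})=\prod_{i=1}^r l(e_{2i})$; an s-cycle is a cycle that is an s-walk. Two cycles are compatibly oriented if they can be oriented so that each induces the same direction on every edge they share; they have odd intersection if they are compatibly oriented and every connected component of their intersection has odd length. A DSR graph is odd$^*$ if all its e-cycles are s-cycles and no two e-cycles have odd intersection. DSR$^{[2]}$ graph: for $n\ge2$, define $\overline{\mathbf L}^A\in\mathbb{R}^{\binom n2\times mn}$, rows indexed by pairs $(i,j)$, $1\le i<j\le n$, columns by pairs $(k,l)$, $1\le k\le m$, $1\le l\le n$, with $\overline{\mathbf L}^A_{(i,j),(k,l)}=A_{jk}$ if $l=i$, $=-A_{ik}$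 if $l=j$, and $0$ otherwise; and $\underline{\mathbf L}^B\in\mathbb{R}^{mn\times\binom n2}$ with $\underline{\mathbf L}^B_{(k,l),(i,j)}=B_{kj}$ if $l=i$, $=-B_{ki}$ if $l=j$, $0$ otherwise. Then $G^{[2]}_{A,B}:=G_{\overline{\mathbf L}^A,\underline{\mathbf L}^B}$. *)

theory Defs
  imports "HOL-Analysis.Analysis" "HOL-Combinatorics.Permutations"
begin

text \<open>An n x m real matrix is represented as a function nat => nat => real;
  only the entries with row index < n and column index < m are relevant.
  Indices are 0-based.\<close>

definition qual_class :: "nat \<Rightarrow> nat \<Rightarrow> (nat \<Rightarrow> nat \<Rightarrow> real) \<Rightarrow> (nat \<Rightarrow> nat \<Rightarrow> real) set" where
  "qual_class n m M = {X. \<forall>i<n. \<forall>j<m. sgn (X i j) = sgn (M i j)}"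

definition qual_class0 :: "nat \<Rightarrow> nat \<Rightarrow> (nat \<Rightarrow> nat \<Rightarrow> real) \<Rightarrow> (nat \<Rightarrow> nat \<Rightarrow> real) set" where
  "qual_class0 n m M = closure (qual_class n m M)"

definition mat_transpose :: "(nat \<Rightarrow> nat \<Rightarrow> real) \<Rightarrow> nat \<Rightarrow> nat \<Rightarrow> real" where
  "mat_transpose M = (\<lambda>i j. M j i)"

definition mat_mult :: "nat \<Rightarrow> (nat \<Rightarrow> nat \<Rightarrow> real) \<Rightarrow> (nat \<Rightarrow> nat \<Rightarrow> real) \<Rightarrow> nat \<Rightarrow> nat \<Rightarrow> real" where
  "mat_mult m A B = (\<lambda>i j. \<Sum>k<m. A i k * B k j)"

definition det_on :: "'a set \<Rightarrow> ('a \<Rightarrow> 'a \<Rightarrow> real) \<Rightarrow> real" where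
  "det_on J M = (\<Sum>p | p permutes J. of_int (sign p) * (\<Prod>i\<in>J. M i (p i)))"

definition P0_matrix :: "'a set \<Rightarrow> ('a \<Rightarrow> 'a \<Rightarrow> real) \<Rightarrow> bool" where
  "P0_matrix I M \<longleftrightarrow> (\<forall>J \<subseteq> I. det_on J M \<ge> 0)"

definition pairs :: "nat \<Rightarrow> (nat \<times> nat) set" where
  "pairs n = {(i,j). i < j \<and> j < n}"

text \<open>Second additive compound: entry ((i,j),(k,l)) is the coefficient of e_i\<and>e_j in
  M e_k \<and> e_l + e_k \<and> M e_l.\<close>
definition add_compound2 :: "(nat \<Rightarrow> nat \<Rightarrow> real) \<Rightarrow> (nat \<times> nat) \<Rightarrow> (nat \<times> nat) \<Rightarrow> real" where
  "add_compound2 M = (\<lambda>(i,j) (k,l).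
      (if l = j then M i k else 0) - (if l = i then M j k else 0)
    + (if k = i then M j l else 0) - (if k = j then M i l else 0))"

definition is_eigenvalue :: "nat \<Rightarrow> (nat \<Rightarrow> nat \<Rightarrow> real) \<Rightarrow> complex \<Rightarrow> bool" where
  "is_eigenvalue n M z \<longleftrightarrow> (\<exists>v :: nat \<Rightarrow> complex. (\<exists>i<n. v i \<noteq> 0) \<and>
      (\<forall>i<n. (\<Sum>j<n. complex_of_real (M i j) * v j) = z * v i))"

record ('s, 'r) dsr =
  Sset :: "'s set"
  Rset :: "'r set"
  Amat :: "'s \<Rightarrow> 'r \<Rightarrow> real"
  Bmat :: "'r \<Rightarrow> 's \<Rightarrow> real"

datatype ('s, 'r) dvert = SV 's | RV 'r

text \<open>Edges: EU = undirected edge (antiparallel arcs of same sign), EA = arc R->S only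
  (from A), EB = arc S->R only (from B).\<close>
datatype ('s, 'r) dedge = EU 's 'r | EA 's 'r | EB 's 'r

definition same_sign_pair :: "('s, 'r) dsr \<Rightarrow> 's \<Rightarrow> 'r \<Rightarrow> bool" where
  "same_sign_pair G s r \<longleftrightarrow> Amat G s r \<noteq> 0 \<and> Bmat G r s \<noteq> 0 \<and> sgn (Amat G s r) = sgn (Bmat G r s)"

definition dsr_edges :: "('s, 'r) dsr \<Rightarrow> ('s, 'r) dedge set" where
  "dsr_edges G =
     {EU s r | s r. s \<in> Sset G \<and> r \<in> Rset G \<and> same_sign_pair G s r}
   \<union> {EA s r | s r. s \<in> Sset G \<and> r \<in> Rset G \<and> Amat G s r \<noteq> 0 \<and> \<not> same_sign_pair G s r}
   \<union> {EB s r | s r. s \<in> Sset G \<and> r \<in> Rset G \<and> Bmat G r s \<noteq> 0 \<and> \<not> same_sign_pair G s r}"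

fun edge_sign :: "('s, 'r) dsr \<Rightarrow> ('s, 'r) dedge \<Rightarrow> real" where
  "edge_sign G (EU s r) = sgn (Amat G s r)"
| "edge_sign G (EA s r) = sgn (Amat G s r)"
| "edge_sign G (EB s r) = sgn (Bmat G r s)"

fun edge_label :: "('s, 'r) dsr \<Rightarrow> ('s, 'r) dedge \<Rightarrow> ereal" where
  "edge_label G (EU s r) = ereal \<bar>Amat G s r\<bar>"
| "edge_label G (EA s r) = ereal \<bar>Amat G s r\<bar>"
| "edge_label G (EB s r) = \<infinity>"

fun traverses :: "('s, 'r) dedge \<Rightarrow> ('s, 'r) dvert \<Rightarrow> ('s, 'r) dvert \<Rightarrow> bool" where
  "traverses (EU s r) u v \<longleftrightarrow> (u = SV s \<and> v = RV r) \<or> (u = RV r \<and> v = SV s)"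
| "traverses (EA s r) u v \<longleftrightarrow> u = RV r \<and> v = SV s"
| "traverses (EB s r) u v \<longleftrightarrow> u = SV s \<and> v = RV r"

fun endpoints :: "('s, 'r) dedge \<Rightarrow> ('s, 'r) dvert set" where
  "endpoints (EU s r) = {SV s, RV r}"
| "endpoints (EA s r) = {SV s, RV r}"
| "endpoints (EB s r) = {SV s, RV r}"

type_synonym ('s, 'r) walk = "('s, 'r) dvert list \<times> ('s, 'r) dedge list"

definition is_walk :: "('s, 'r) dsr \<Rightarrow> ('s, 'r) walk \<Rightarrow> bool" where
  "is_walk G W \<longleftrightarrow> (case W of (vs, es) \<Rightarrow>
      length vs = length es + 1 \<and> set es \<subseteq> dsr_edges G \<and>
      (\<forall>t < length es. traverses (es ! t) (vs ! t) (vs ! Suc t)))"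

definition walk_len :: "('s, 'r) walk \<Rightarrow> nat" where
  "walk_len W = length (snd W)"

definition is_closed_walk :: "('s, 'r) dsr \<Rightarrow> ('s, 'r) walk \<Rightarrow> bool" where
  "is_closed_walk G W \<longleftrightarrow> is_walk G W \<and> hd (fst W) = last (fst W)"

definition is_cycle :: "('s, 'r) dsr \<Rightarrow> ('s, 'r) walk \<Rightarrow> bool" where
  "is_cycle G W \<longleftrightarrow> is_closed_walk G W \<and> snd W \<noteq> [] \<and>
      distinct (butlast (fst W)) \<and> distinct (snd W)"

definition walk_sign :: "('s, 'r) dsr \<Rightarrow> ('s, 'r) walk \<Rightarrow> real" where
  "walk_sign G W = prod_list (map (edge_sign G) (snd W))"

definition walk_parity :: "('s, 'r) dsr \<Rightarrow> ('s, 'r) walk \<Rightarrow> real" where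
  "walk_parity G W = (-1) ^ (walk_len W div 2) * walk_sign G W"

definition e_cycle :: "('s, 'r) dsr \<Rightarrow> ('s, 'r) walk \<Rightarrow> bool" where
  "e_cycle G W \<longleftrightarrow> is_cycle G W \<and> walk_parity G W = 1"

definition o_cycle :: "('s, 'r) dsr \<Rightarrow> ('s, 'r) walk \<Rightarrow> bool" where
  "o_cycle G W \<longleftrightarrow> is_cycle G W \<and> walk_parity G W = -1"

definition s_walk :: "('s, 'r) dsr \<Rightarrow> ('s, 'r) walk \<Rightarrow> bool" where
  "s_walk G W \<longleftrightarrow> is_closed_walk G W \<and>
     (\<forall>e \<in> set (snd W). edge_label G e \<noteq> \<infinity>) \<and>
     (\<Prod>i \<in> {i. i < walk_len W \<and> even i}. edge_label G (snd W ! i))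
       = (\<Prod>i \<in> {i. i < walk_len W \<and> odd i}. edge_label G (snd W ! i))"

definition s_cycle :: "('s, 'r) dsr \<Rightarrow> ('s, 'r) walk \<Rightarrow> bool" where
  "s_cycle G W \<longleftrightarrow> is_cycle G W \<and> s_walk G W"

definition reverse_walk :: "('s, 'r) walk \<Rightarrow> ('s, 'r) walk" where
  "reverse_walk W = (rev (fst W), rev (snd W))"

definition induces_dir :: "('s, 'r) walk \<Rightarrow> ('s, 'r) dedge \<Rightarrow> ('s, 'r) dvert \<Rightarrow> ('s, 'r) dvert \<Rightarrow> bool" where
  "induces_dir W e u v \<longleftrightarrow> (\<exists>t < length (snd W). snd W ! t = e \<and> fst W ! t = u \<and> fst W ! Suc t = v)"

definition compatibly_oriented :: "('s, 'r) dsr \<Rightarrow> ('s, 'r) walk \<Rightarrow> ('s, 'r) walk \<Rightarrow> bool" where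
  "compatibly_oriented G C D \<longleftrightarrow>
     (\<exists>C' \<in> {C, reverse_walk C}. \<exists>D' \<in> {D, reverse_walk D}. is_walk G C' \<and> is_walk G D' \<and>
        (\<forall>e \<in> set (snd C) \<inter> set (snd D). \<forall>u v. induces_dir C' e u v \<longleftrightarrow> induces_dir D' e u v))"

text \<open>The intersection of two cycles is the subgraph consisting of their common vertices
  and common edges. Its connected components are taken with respect to the common edges; the
  length of a component is the number of (common) edges in it.\<close>
definition common_edges :: "('s, 'r) walk \<Rightarrow> ('s, 'r) walk \<Rightarrow> ('s, 'r) dedge set" where
  "common_edges C D = set (snd C) \<inter> set (snd D)"

definition common_verts :: "('s, 'r) walk \<Rightarrow> ('s, 'r) walk \<Rightarrow> ('s, 'r) dvert set" where
  "common_verts C D = set (fst C) \<inter> set (fst D)"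

definition inter_adj :: "('s, 'r) walk \<Rightarrow> ('s, 'r) walk \<Rightarrow> (('s, 'r) dvert \<times> ('s, 'r) dvert) set" where
  "inter_adj C D = {(x, y). \<exists>e \<in> common_edges C D. endpoints e = {x, y}}"

definition component_length :: "('s, 'r) walk \<Rightarrow> ('s, 'r) walk \<Rightarrow> ('s, 'r) dvert \<Rightarrow> nat" where
  "component_length C D u =
     card {e \<in> common_edges C D. \<exists>x \<in> endpoints e. (u, x) \<in> (inter_adj C D)\<^sup>*}"

definition odd_intersection :: "('s, 'r) dsr \<Rightarrow> ('s, 'r) walk \<Rightarrow> ('s, 'r) walk \<Rightarrow> bool" where
  "odd_intersection G C D \<longleftrightarrow> compatibly_oriented G C D \<and>
     (\<forall>u \<in> common_verts C D. odd (component_length C D u))"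

definition odd_star :: "('s, 'r) dsr \<Rightarrow> bool" where
  "odd_star G \<longleftrightarrow> (\<forall>C. e_cycle G C \<longrightarrow> s_cycle G C) \<and>
     \<not> (\<exists>C D. e_cycle G C \<and> e_cycle G D \<and> odd_intersection G C D)"

definition DSR_graph :: "nat \<Rightarrow> nat \<Rightarrow> (nat \<Rightarrow> nat \<Rightarrow> real) \<Rightarrow> (nat \<Rightarrow> nat \<Rightarrow> real) \<Rightarrow> (nat, nat) dsr" where
  "DSR_graph n m A B = \<lparr>Sset = {..<n}, Rset = {..<m}, Amat = A, Bmat = B\<rparr>"

definition Lbar :: "(nat \<Rightarrow> nat \<Rightarrow> real) \<Rightarrow> nat \<times> nat \<Rightarrow> nat \<times> nat \<Rightarrow> real" where
  "Lbar A = (\<lambda>(i,j) (k,l). if l = i then A j k else if l = j then - A i k else 0)"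

definition Lunder :: "(nat \<Rightarrow> nat \<Rightarrow> real) \<Rightarrow> nat \<times> nat \<Rightarrow> nat \<times> nat \<Rightarrow> real" where
  "Lunder B = (\<lambda>(k,l) (i,j). if l = i then B k j else if l = j then - B k i else 0)"

definition DSR2_graph :: "nat \<Rightarrow> nat \<Rightarrow> (nat \<Rightarrow> nat \<Rightarrow> real) \<Rightarrow> (nat \<Rightarrow> nat \<Rightarrow> real) \<Rightarrow> (nat \<times> nat, nat \<times> nat) dsr" where
  "DSR2_graph n m A B = \<lparr>Sset = pairs n, Rset = {(k,l). k < m \<and> l < n}, Amat = Lbar A, Bmat = Lunder B\<rparr>"

end

theory Submission
  imports Defs
begin

text \<open>
  Membership in the closure of the qualitative class makes $A_{ik} B_{ki} \ge 0$, so an edge of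
  $G_{A,B}$ is determined by its endpoints. Conditions (i) and (ii) then become polynomial
  implications: if the product of the entries of $A$ and $B$ along a closed walk
  $S_b \to R_k \to S_a \to R_{k'} \to S_b$ is positive, then
  $A_{ak} A_{bk'} = A_{bk} A_{ak'}$, and similarly for walks of length six. Both implications
  persist when the R-vertices coincide.

  For $n = 3$ an R-vertex $(k,l)$ of $G^{[2]}_{A,B}$ is adjacent only to the two pairs
  containing $l$. Hence its cycles have length 4 or 6 and project to closed walks of $G_{A,B}$,
  with a change of sign exactly for length 6. Moreover a cycle through an R-vertex uses both of
  its edges, so the components of an intersection of two cycles have even length, and any two
  cycles share one of the three S-vertices.

  With $M = AB$, the principal minors of $M^{[2]}$ are those of $(\mathrm{tr}\, M) I - M$. Their
  nonnegativity reduces to that of the diagonal of $M$, of its principal $2 \times 2$ minors, and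
  of $2 M_{00} M_{11} M_{22} - M_{01} M_{12} M_{20} - M_{02} M_{10} M_{21}$; the last two are sums
  of products $(p - q)(p' - q')$, where $p, q$ are monomials in $A$ and $p', q'$ in $B$, each of
  which is nonnegative by the implications above. Finally $e_1, e_2 \ge 0$ and
  $e_1 e_2 \ge e_3$ for the coefficients of the characteristic polynomial exclude nonreal roots
  in the open left half-plane.
\<close>

subsection \<open>Cycles in sign-compatible DSR graphs\<close>

definition sign_compatible :: "('s, 'r) dsr \<Rightarrow> bool" where
  "sign_compatible G \<longleftrightarrow> (\<forall>s \<in> Sset G. \<forall>r \<in> Rset G. 0 \<le> Amat G s r * Bmat G r s)"

text \<open>Sign compatibility leaves at most one edge between \<open>s\<close> and
  \<open>r\<close>, so an edge can be treated as a function of its endpoints. If both entries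
  vanish, the value is the non-edge \<open>EB s r\<close>; being an edge must then be stated
  separately through nonzero entries.\<close>

definition edge_between :: "('s, 'r) dsr \<Rightarrow> 's \<Rightarrow> 'r \<Rightarrow> ('s, 'r) dedge" where
  "edge_between G s r =
     (if Amat G s r = 0 then EB s r else if Bmat G r s = 0 then EA s r else EU s r)"

lemma edge_between_inject [simp]:
  "edge_between G s r = edge_between G s' r' \<longleftrightarrow> s = s' \<and> r = r'"
  by (auto simp: edge_between_def)

lemma endpoints_edge_between [simp]: "endpoints (edge_between G s r) = {SV s, RV r}"
  by (auto simp: edge_between_def)

lemma edge_label_edge_between:
  "edge_label G (edge_between G s r) = (if Amat G s r = 0 then \<infinity> else ereal \<bar>Amat G s r\<bar>)"
  by (auto simp: edge_between_def)

lemma same_sign_pair_iff: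
  assumes "sign_compatible G" "s \<in> Sset G" "r \<in> Rset G"
  shows "same_sign_pair G s r \<longleftrightarrow> Amat G s r \<noteq> 0 \<and> Bmat G r s \<noteq> 0"
proof -
  have "0 \<le> Amat G s r * Bmat G r s" using assms by (auto simp: sign_compatible_def)
  then show ?thesis
    unfolding same_sign_pair_def by (auto simp: sgn_if zero_le_mult_iff)
qed

lemma edge_sign_edge_between:
  assumes "sign_compatible G" "s \<in> Sset G" "r \<in> Rset G"
  shows "Amat G s r \<noteq> 0 \<Longrightarrow> edge_sign G (edge_between G s r) = sgn (Amat G s r)"
    and "Bmat G r s \<noteq> 0 \<Longrightarrow> edge_sign G (edge_between G s r) = sgn (Bmat G r s)"
  using same_sign_pair_iff[OF assms]
  by (auto simp: edge_between_def same_sign_pair_def)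

definition step :: "('s, 'r) dsr \<Rightarrow> ('s, 'r) dedge \<Rightarrow> ('s, 'r) dvert \<Rightarrow> ('s, 'r) dvert \<Rightarrow> bool" where
  "step G e u v \<longleftrightarrow> e \<in> dsr_edges G \<and> traverses e u v"

lemma step_iff:
  assumes "sign_compatible G"
  shows "step G e u v \<longleftrightarrow>
    (\<exists>s\<in>Sset G. \<exists>r\<in>Rset G. e = edge_between G s r \<and>
       (u = SV s \<and> v = RV r \<and> Bmat G r s \<noteq> 0 \<or> u = RV r \<and> v = SV s \<and> Amat G s r \<noteq> 0))"
  unfolding step_def dsr_edges_def edge_between_def
  using same_sign_pair_iff[OF assms]
  by (cases e) auto

lemma step_simps:
  assumes "sign_compatible G"
  shows "step G e (SV s) (RV r) \<longleftrightarrow>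
      s \<in> Sset G \<and> r \<in> Rset G \<and> e = edge_between G s r \<and> Bmat G r s \<noteq> 0"
    and "step G e (RV r) (SV s) \<longleftrightarrow>
      s \<in> Sset G \<and> r \<in> Rset G \<and> e = edge_between G s r \<and> Amat G s r \<noteq> 0"
    and "\<not> step G e (SV s) (SV s')"
    and "\<not> step G e (RV r) (RV r')"
  by (auto simp: step_iff[OF assms])

lemma is_walk_Cons:
  "is_walk G (u # v # vs, e # es) \<longleftrightarrow> step G e u v \<and> is_walk G (v # vs, es)"
  by (auto simp: is_walk_def step_def less_Suc_eq_0_disj)

lemma is_walk_Nil: "is_walk G (vs, []) \<longleftrightarrow> length vs = 1"
  by (auto simp: is_walk_def)

lemma is_walk_single_vertex [simp]: "is_walk G ([v], es) \<longleftrightarrow> es = []"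
  by (auto simp: is_walk_def)

lemma even_indices:
  "{i. i < (4::nat) \<and> even i} = {0,2}" "{i. i < (4::nat) \<and> odd i} = {1,3}"
  "{i. i < (6::nat) \<and> even i} = {0,2,4}" "{i. i < (6::nat) \<and> odd i} = {1,3,5}"
proof -
  have *: "i < 6 \<longleftrightarrow> i = 0 \<or> i = 1 \<or> i = 2 \<or> i = 3 \<or> i = 4 \<or> i = 5"
    "i < 4 \<longleftrightarrow> i = 0 \<or> i = 1 \<or> i = 2 \<or> i = 3" for i :: nat
    by auto
  show "{i. i < (4::nat) \<and> even i} = {0,2}" "{i. i < (4::nat) \<and> odd i} = {1,3}"
  "{i. i < (6::nat) \<and> even i} = {0,2,4}" "{i. i < (6::nat) \<and> odd i} = {1,3,5}"
    unfolding * by auto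
qed

text \<open>The flag selects whether the cycle is listed from its S-vertex \<open>s\<close> or from its R-vertex \<open>r\<close>.\<close>

definition cycle4 :: "('s, 'r) dsr \<Rightarrow> bool \<Rightarrow> 's \<Rightarrow> 'r \<Rightarrow> 's \<Rightarrow> 'r \<Rightarrow> ('s, 'r) walk" where
  "cycle4 G at_S s r s' r' =
    (let a = edge_between G s r; b = edge_between G s' r;
         c = edge_between G s' r'; d = edge_between G s r'
     in if at_S then ([SV s, RV r, SV s', RV r', SV s], [a, b, c, d])
        else ([RV r, SV s', RV r', SV s, RV r], [b, c, d, a]))"

definition cycle6 ::
  "('s, 'r) dsr \<Rightarrow> bool \<Rightarrow> 's \<Rightarrow> 'r \<Rightarrow> 's \<Rightarrow> 'r \<Rightarrow> 's \<Rightarrow> 'r \<Rightarrow> ('s, 'r) walk" where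
  "cycle6 G at_S s r s' r' s'' r'' =
    (let a = edge_between G s r; b = edge_between G s' r;
         c = edge_between G s' r'; d = edge_between G s'' r';
         e = edge_between G s'' r''; f = edge_between G s r''
     in if at_S then ([SV s, RV r, SV s', RV r', SV s'', RV r'', SV s], [a, b, c, d, e, f])
        else ([RV r, SV s', RV r', SV s'', RV r'', SV s, RV r], [b, c, d, e, f, a]))"

lemma is_cycle_cycle4:
  assumes "sign_compatible G"
  shows "is_cycle G (cycle4 G at_S s r s' r') \<longleftrightarrow>
    {s, s'} \<subseteq> Sset G \<and> {r, r'} \<subseteq> Rset G \<and> s \<noteq> s' \<and> r \<noteq> r' \<and>
    Bmat G r s \<noteq> 0 \<and> Amat G s' r \<noteq> 0 \<and> Bmat G r' s' \<noteq> 0 \<and> Amat G s r' \<noteq> 0"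
  by (auto simp: cycle4_def Let_def is_cycle_def is_closed_walk_def is_walk_Cons step_simps[OF assms])

lemma is_cycle_cycle6:
  assumes "sign_compatible G"
  shows "is_cycle G (cycle6 G at_S s r s' r' s'' r'') \<longleftrightarrow>
    {s, s', s''} \<subseteq> Sset G \<and> {r, r', r''} \<subseteq> Rset G \<and> distinct [s, s', s''] \<and> distinct [r, r', r''] \<and>
    Bmat G r s \<noteq> 0 \<and> Amat G s' r \<noteq> 0 \<and> Bmat G r' s' \<noteq> 0 \<and> Amat G s'' r' \<noteq> 0 \<and>
    Bmat G r'' s'' \<noteq> 0 \<and> Amat G s r'' \<noteq> 0"
  by (auto simp: cycle6_def Let_def is_cycle_def is_closed_walk_def is_walk_Cons step_simps[OF assms])

lemma walk_len_cycle4 [simp]: "walk_len (cycle4 G at_S s r s' r') = 4"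
  by (simp add: walk_len_def cycle4_def Let_def)

lemma walk_len_cycle6 [simp]: "walk_len (cycle6 G at_S s r s' r' s'' r'') = 6"
  by (simp add: walk_len_def cycle6_def Let_def)

text \<open>An edge has the sign of whichever entry belongs to the direction of traversal, so the
  product runs over the traversed arcs only. Half the length is 2 here, hence no extra sign; for
  length six it is 3, which gives the minus sign.\<close>

lemma walk_parity_cycle4:
  assumes "sign_compatible G" "is_cycle G (cycle4 G at_S s r s' r')"
  shows "walk_parity G (cycle4 G at_S s r s' r') =
    sgn (Amat G s' r * Bmat G r s * Amat G s r' * Bmat G r' s')"
  using assms(2) unfolding is_cycle_cycle4[OF assms(1)]
  by (simp add: walk_parity_def walk_sign_def, simp add: cycle4_def Let_def edge_sign_edge_between[OF assms(1)] sgn_mult)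

lemma walk_parity_cycle6:
  assumes "sign_compatible G" "is_cycle G (cycle6 G at_S s r s' r' s'' r'')"
  shows "walk_parity G (cycle6 G at_S s r s' r' s'' r'') =
    - sgn (Amat G s' r * Bmat G r s * Amat G s r'' * Bmat G r'' s'' * Amat G s'' r' * Bmat G r' s')"
  using assms(2) unfolding is_cycle_cycle6[OF assms(1)]
  by (simp add: walk_parity_def walk_sign_def, simp add: cycle6_def Let_def edge_sign_edge_between[OF assms(1)] sgn_mult)

text \<open>The arcs from R to S that the cycle traverses have nonzero entries of A, so the equation
  forces the two other entries to be nonzero as well. Finiteness of the labels is thus absorbed into
  it.\<close>

lemma s_walk_cycle4:
  assumes "sign_compatible G" "is_cycle G (cycle4 G at_S s r s' r')"
  shows "s_walk G (cycle4 G at_S s r s' r') \<longleftrightarrow>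
    \<bar>Amat G s' r * Amat G s r'\<bar> = \<bar>Amat G s r * Amat G s' r'\<bar>"
proof -
  have nz: "Amat G s' r \<noteq> 0" "Amat G s r' \<noteq> 0"
    using assms(2) by (simp_all add: is_cycle_cycle4[OF assms(1)])
  have cl: "is_closed_walk G (cycle4 G at_S s r s' r')"
    using assms(2) by (simp add: is_cycle_def)
  define l where "l s r = edge_label G (edge_between G s r)" for s r
  have "s_walk G (cycle4 G at_S s r s' r') \<longleftrightarrow> l s r \<noteq> \<infinity> \<and> l s' r' \<noteq> \<infinity> \<and>
    l s' r * l s r' = l s r * l s' r'"
    using nz cl unfolding s_walk_def walk_len_cycle4 even_indices
    by (cases at_S) (auto simp: cycle4_def Let_def l_def[symmetric] ac_simps,
        auto simp: l_def edge_label_edge_between)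
  also have "\<dots> \<longleftrightarrow> \<bar>Amat G s' r * Amat G s r'\<bar> = \<bar>Amat G s r * Amat G s' r'\<bar>"
    using nz by (auto simp: l_def edge_label_edge_between abs_mult)
  finally show ?thesis .
qed

lemma s_walk_cycle6:
  assumes "sign_compatible G" "is_cycle G (cycle6 G at_S s r s' r' s'' r'')"
  shows "s_walk G (cycle6 G at_S s r s' r' s'' r'') \<longleftrightarrow>
    \<bar>Amat G s' r * Amat G s r'' * Amat G s'' r'\<bar> = \<bar>Amat G s r * Amat G s'' r'' * Amat G s' r'\<bar>"
proof -
  have nz: "Amat G s' r \<noteq> 0" "Amat G s r'' \<noteq> 0" "Amat G s'' r' \<noteq> 0"
    using assms(2) by (simp_all add: is_cycle_cycle6[OF assms(1)])
  have cl: "is_closed_walk G (cycle6 G at_S s r s' r' s'' r'')"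
    using assms(2) by (simp add: is_cycle_def)
  define l where "l s r = edge_label G (edge_between G s r)" for s r
  have "s_walk G (cycle6 G at_S s r s' r' s'' r'') \<longleftrightarrow>
    l s r \<noteq> \<infinity> \<and> l s'' r'' \<noteq> \<infinity> \<and> l s' r' \<noteq> \<infinity> \<and>
    l s' r * l s r'' * l s'' r' = l s r * l s'' r'' * l s' r'"
    using nz cl unfolding s_walk_def walk_len_cycle6 even_indices
    by (cases at_S) (auto simp: cycle6_def Let_def l_def[symmetric] ac_simps,
        auto simp: l_def edge_label_edge_between)
  also have "\<dots> \<longleftrightarrow>
    \<bar>Amat G s' r * Amat G s r'' * Amat G s'' r'\<bar> = \<bar>Amat G s r * Amat G s'' r'' * Amat G s' r'\<bar>"
    using nz by (auto simp: l_def edge_label_edge_between abs_mult)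
  finally show ?thesis .
qed

lemma card_le_3_not_distinct4:
  assumes "card S \<le> 3" "finite S" "{a, b, c, d} \<subseteq> S"
  shows "\<not> distinct [a, b, c, d]"
proof
  assume "distinct [a, b, c, d]"
  then have "card {a, b, c, d} = 4" by auto
  then show False using card_mono[OF assms(2,3)] assms(1) by simp
qed

text \<open>The graph is bipartite, so a closed walk has even length; three S-vertices bound the
  length of a cycle by six; and length two would need two edges between the same endpoints.\<close>

lemma cycle_cases:
  assumes G: "sign_compatible G" and S: "finite (Sset G)" "card (Sset G) \<le> 3"
    and W: "is_cycle G W"
  obtains (4) at_S s r s' r' where "W = cycle4 G at_S s r s' r'"
    | (6) at_S s r s' r' s'' r'' where "W = cycle6 G at_S s r s' r' s'' r''"
proof -
  obtain vs es where W_eq: "W = (vs, es)" by (cases W)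
  have w: "is_walk G (vs, es)" and hl: "hd vs = last vs" and ne: "es \<noteq> []"
    and d: "distinct (butlast vs)"
    using W unfolding W_eq is_cycle_def is_closed_walk_def by auto
  have len: "length vs = Suc (length es)" using w by (simp add: is_walk_def)
  note st = step_iff[OF G]
  note no4 = card_le_3_not_distinct4[OF S(2,1)]
  show thesis
  proof (cases "length es < 8")
    \<comment> \<open>With at least eight edges, \<open>v0\<close> to \<open>v7\<close> are distinct
      and contain four S-vertices, whichever kind \<open>v0\<close> is.\<close>
    case False
    then obtain e0 e1 e2 e3 e4 e5 e6 es' where es: "es = e0 # e1 # e2 # e3 # e4 # e5 # e6 # es'"
      and "es' \<noteq> []"
      by (auto simp: not_less numeral_eq_Suc Suc_le_length_iff)
    moreover obtain v0 v1 v2 v3 v4 v5 v6 v7 vs' where vs: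
      "vs = v0 # v1 # v2 # v3 # v4 # v5 # v6 # v7 # vs'" and "vs' \<noteq> []"
      using len False by (auto simp: not_less numeral_eq_Suc length_Suc_conv Suc_le_length_iff)
    ultimately have "distinct [v0, v1, v2, v3, v4, v5, v6, v7]"
      and steps: "step G e0 v0 v1" "step G e1 v1 v2" "step G e2 v2 v3" "step G e3 v3 v4"
        "step G e4 v4 v5" "step G e5 v5 v6" "step G e6 v6 v7"
      using d w by (auto simp: is_walk_Cons)
    then have False
    proof (cases v0)
      case (SV s0)
      then obtain s2 s4 s6 where "v2 = SV s2" "v4 = SV s4" "v6 = SV s6"
        "{s0, s2, s4, s6} \<subseteq> Sset G"
        using steps unfolding st by auto
      then show False using no4[of s0 s2 s4 s6] SV \<open>distinct [v0, v1, v2, v3, v4, v5, v6, v7]\<close>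
        by auto
    next
      case (RV r)
      then obtain s1 s3 s5 s7 where "v1 = SV s1" "v3 = SV s3" "v5 = SV s5" "v7 = SV s7"
        "{s1, s3, s5, s7} \<subseteq> Sset G"
        using steps unfolding st by auto
      then show False using no4[of s1 s3 s5 s7] \<open>distinct [v0, v1, v2, v3, v4, v5, v6, v7]\<close>
        by auto
    qed
    then show thesis ..
  next
    case True
    have par: "is_walk G (us, fs) \<Longrightarrow>
      (\<exists>s. hd us = SV s) = (\<exists>s. last us = SV s) \<longleftrightarrow> even (length fs)" for us fs
    proof (induction fs arbitrary: us)
      case (Cons f fs)
      then obtain u v us' where us: "us = u # v # us'"
        by (auto simp: is_walk_def length_Suc_conv)
      then show ?case using Cons.IH[of "v # us'"] Cons.prems
        by (auto simp: is_walk_Cons st)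
    qed (auto simp: is_walk_Nil length_Suc_conv)
    have "even (length es)" using par[OF w] hl by simp
    \<comment> \<open>Both edges of such a walk would be the same \<open>edge_between\<close>,
      against distinctness.\<close>
    moreover have "length es \<noteq> 2"
    proof
      assume "length es = 2"
      then obtain e0 e1 v0 v1 v2 where "es = [e0, e1]" "vs = [v0, v1, v2]"
        using len by (auto simp: numeral_eq_Suc length_Suc_conv)
      then show False using W w hl unfolding W_eq is_cycle_def by (auto simp: is_walk_Cons st)
    qed
    ultimately have "length es = 4 \<or> length es = 6" using True ne
        length_0_conv[of es] by presburger
    then show thesis
    proof
      assume "length es = 4"
      then obtain e0 e1 e2 e3 v0 v1 v2 v3 where eq: "es = [e0, e1, e2, e3]" "vs = [v0, v1, v2, v3, v0]"
        using len hl by (auto simp: numeral_eq_Suc length_Suc_conv)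
      have steps: "step G e0 v0 v1" "step G e1 v1 v2" "step G e2 v2 v3" "step G e3 v3 v0"
        using w by (auto simp: eq is_walk_Cons)
      show thesis
      proof (cases v0)
        case (SV s)
        then obtain r s' r' where "v1 = RV r" "v2 = SV s'" "v3 = RV r'"
          using steps unfolding st by auto
        then have "W = cycle4 G True s r s' r'"
          using steps SV by (auto simp: cycle4_def W_eq eq step_simps[OF G])
        then show thesis by (rule 4)
      next
        case (RV r)
        then obtain s' r' s where "v1 = SV s'" "v2 = RV r'" "v3 = SV s"
          using steps unfolding st by auto
        then have "W = cycle4 G False s r s' r'"
          using steps RV by (auto simp: cycle4_def W_eq eq step_simps[OF G])
        then show thesis by (rule 4)
      qed
    next
      assume "length es = 6"
      then obtain e0 e1 e2 e3 e4 e5 v0 v1 v2 v3 v4 v5 where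
        eq: "es = [e0, e1, e2, e3, e4, e5]" "vs = [v0, v1, v2, v3, v4, v5, v0]"
        using len hl by (auto simp: numeral_eq_Suc length_Suc_conv)
      have steps: "step G e0 v0 v1" "step G e1 v1 v2" "step G e2 v2 v3" "step G e3 v3 v4"
          "step G e4 v4 v5" "step G e5 v5 v0"
        using w by (auto simp: eq is_walk_Cons)
      show thesis
      proof (cases v0)
        case (SV s)
        then obtain r s' r' s'' r'' where
          "v1 = RV r" "v2 = SV s'" "v3 = RV r'" "v4 = SV s''" "v5 = RV r''"
          using steps unfolding st by auto
        then have "W = cycle6 G True s r s' r' s'' r''"
          using steps SV by (auto simp: cycle6_def W_eq eq step_simps[OF G])
        then show thesis by (rule 6)
      next
        case (RV r)
        then obtain s' r' s'' r'' s where
          "v1 = SV s'" "v2 = RV r'" "v3 = SV s''" "v4 = RV r''" "v5 = SV s"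
          using steps unfolding st by auto
        then have "W = cycle6 G False s r s' r' s'' r''"
          using steps RV by (auto simp: cycle6_def W_eq eq step_simps[OF G])
        then show thesis by (rule 6)
      qed
    qed
  qed
qed

subsection \<open>Matrices of size three\<close>

lemma qual_class0_sign:
  assumes "X \<in> qual_class0 n m C" "i < n" "j < m"
  shows "0 \<le> X i j * C i j" and "C i j = 0 \<Longrightarrow> X i j = 0"
proof -
  have cont: "continuous_on UNIV (\<lambda>X :: nat \<Rightarrow> nat \<Rightarrow> real. X i j)"
    by (rule continuous_on_product_then_coordinatewise[OF continuous_on_product_coordinates])
  \<comment> \<open>The implication from \<open>C i j = 0\<close> to \<open>X i j = 0\<close> is
    written as an equation whose factor is 1 if \<open>C i j = 0\<close> and 0 otherwise, so that
    both conditions are visibly closed.\<close>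
  let ?K = "{X :: nat \<Rightarrow> nat \<Rightarrow> real. 0 \<le> X i j * C i j} \<inter> {X. X i j * (1 - \<bar>sgn (C i j)\<bar>) = 0}"
  have "closed ?K"
    by (intro closed_Int closed_Collect_le closed_Collect_eq continuous_intros cont)
  moreover have "qual_class n m C \<subseteq> ?K"
  proof
    fix X assume "X \<in> qual_class n m C"
    then have "sgn (X i j) = sgn (C i j)" using assms(2,3) by (simp add: qual_class_def)
    then show "X \<in> ?K" by (auto simp: sgn_if zero_le_mult_iff split: if_splits)
  qed
  ultimately have "qual_class0 n m C \<subseteq> ?K"
    unfolding qual_class0_def by (rule closure_minimal[rotated])
  with assms(1) show "0 \<le> X i j * C i j" and "C i j = 0 \<Longrightarrow> X i j = 0" by auto
qed

lemma qual_class0_mult_nonneg: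
  assumes "A \<in> qual_class0 n m C" "mat_transpose B \<in> qual_class0 n m C" "i < n" "k < m"
  shows "0 \<le> A i k * B k i"
  using qual_class0_sign[OF assms(1,3,4)] qual_class0_sign[OF assms(2,3,4)]
  by (auto simp: mat_transpose_def zero_le_mult_iff)

section \<open>Characteristic polynomial of a 3 x 3 matrix and roots of real cubics\<close>

lemma sum_lessThan_3: "(\<Sum>j<3. f j) = f 0 + f 1 + f (2::nat)" for f :: "nat \<Rightarrow> 'a::comm_monoid_add"
  by (simp add: eval_nat_numeral add.assoc)

definition tr3 :: "(nat \<Rightarrow> nat \<Rightarrow> real) \<Rightarrow> real" where
  "tr3 M = M 0 0 + M 1 1 + M 2 2"

definition minor2 :: "(nat \<Rightarrow> nat \<Rightarrow> real) \<Rightarrow> nat \<Rightarrow> nat \<Rightarrow> real" where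
  "minor2 M a b = M a a * M b b - M a b * M b a"

definition det3 :: "(nat \<Rightarrow> nat \<Rightarrow> real) \<Rightarrow> real" where
  "det3 M = M 0 0 * (M 1 1 * M 2 2 - M 1 2 * M 2 1) - M 0 1 * (M 1 0 * M 2 2 - M 1 2 * M 2 0)
    + M 0 2 * (M 1 0 * M 2 1 - M 1 1 * M 2 0)"

text \<open>Multiplying (zI - M)v = 0 by the adjugate of zI - M gives det(zI - M) v = 0; since some
  coordinate of v is nonzero, the determinant vanishes.\<close>

lemma is_eigenvalue_3_root:
  assumes "is_eigenvalue 3 M z"
  shows "z ^ 3 - of_real (tr3 M) * z ^ 2
    + of_real (minor2 M 0 1 + minor2 M 0 2 + minor2 M 1 2) * z - of_real (det3 M) = 0"
    (is "?p = 0")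
proof -
  obtain v :: "nat \<Rightarrow> complex" and i where "i < 3" "v i \<noteq> 0"
    and eq: "\<And>i. i < 3 \<Longrightarrow> (\<Sum>j<3. complex_of_real (M i j) * v j) = z * v i"
    using assms by (auto simp: is_eigenvalue_def)
  define a where "a i j = complex_of_real (M i j)" for i j
  have e: "a 0 0 * v 0 + a 0 1 * v 1 + a 0 2 * v 2 = z * v 0"
    "a 1 0 * v 0 + a 1 1 * v 1 + a 1 2 * v 2 = z * v 1"
    "a 2 0 * v 0 + a 2 1 * v 1 + a 2 2 * v 2 = z * v 2"
    using eq[of 0] eq[of 1] eq[of 2] by (simp_all add: sum_lessThan_3 a_def)
  have p: "?p = z ^ 3 - (a 0 0 + a 1 1 + a 2 2) * z ^ 2
    + (a 0 0 * a 1 1 - a 0 1 * a 1 0 + (a 0 0 * a 2 2 - a 0 2 * a 2 0)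
      + (a 1 1 * a 2 2 - a 1 2 * a 2 1)) * z
    - (a 0 0 * (a 1 1 * a 2 2 - a 1 2 * a 2 1) - a 0 1 * (a 1 0 * a 2 2 - a 1 2 * a 2 0)
    + a 0 2 * (a 1 0 * a 2 1 - a 1 1 * a 2 0))"
    by (simp add: a_def tr3_def minor2_def det3_def)
  have "?p * v 0 = 0" "?p * v 1 = 0" "?p * v 2 = 0"
    unfolding p using e by algebra+
  moreover have "i = 0 \<or> i = 1 \<or> i = 2" using \<open>i < 3\<close> by auto
  ultimately show ?thesis using \<open>v i \<noteq> 0\<close> by auto
qed

text \<open>Since y is nonzero, the imaginary part of the equation can be divided by y and
  determines \<open>y\<^sup>2\<close>; inserting this into the real part leaves a sum that is
  positive for negative x.\<close>

lemma nonreal_cubic_root_Re_nonneg: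
  fixes z :: complex and e1 e2 e3 :: real
  assumes root: "z ^ 3 - of_real e1 * z ^ 2 + of_real e2 * z - of_real e3 = 0"
    and "Im z \<noteq> 0" and nn: "0 \<le> e1" "0 \<le> e2" "e3 \<le> e1 * e2"
  shows "0 \<le> Re z"
proof (rule ccontr)
  define x y where "x = Re z" "y = Im z"
  assume "\<not> 0 \<le> Re z"
  then have x: "x < 0" by (simp add: x_y_def)
  have z: "z = Complex x y" by (simp add: x_y_def)
  have "y * (3 * x\<^sup>2 - y\<^sup>2 - 2 * e1 * x + e2) = 0"
    using arg_cong[OF root, of Im] by (simp add: z power2_eq_square power3_eq_cube algebra_simps)
  then have y: "y\<^sup>2 = 3 * x\<^sup>2 - 2 * e1 * x + e2"
    using \<open>Im z \<noteq> 0\<close> by (auto simp: x_y_def)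
  have "x ^ 3 - 3 * x * y\<^sup>2 - e1 * (x\<^sup>2 - y\<^sup>2) + e2 * x - e3 = 0"
    using arg_cong[OF root, of Re] by (simp add: z power2_eq_square power3_eq_cube algebra_simps)
  \<comment> \<open>If e1, e2, e3 are the coefficients belonging to M, this is, up to sign, the
    characteristic polynomial of the second additive compound at 2x, the sum of z and its
    conjugate.\<close>
  then have "8 * (- x) ^ 3 + 8 * (e1 * x\<^sup>2) + 2 * ((e1\<^sup>2 + e2) * (- x)) + (e1 * e2 - e3) = 0"
    unfolding y by (simp add: power2_eq_square power3_eq_cube algebra_simps)
  moreover have "(- x) ^ 3 > 0" "0 \<le> e1 * x\<^sup>2" "0 \<le> (e1\<^sup>2 + e2) * (- x)"
    using x nn by (auto intro!: mult_nonneg_nonneg zero_less_power mult_nonneg_nonpos)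
  ultimately show False using nn by linarith
qed

section \<open>Small determinants and the principal minors of the compound\<close>

lemma pairs_3: "pairs 3 = {(0,1), (0,2), (1,2)}"
  by (auto simp: pairs_def)

lemma det_on_empty [simp]: "det_on {} M = 1"
  by (simp add: det_on_def)

lemma det_on_singleton: "det_on {a} M = M a a"
  by (simp add: det_on_def)

lemma det_on_insert:
  assumes "finite J" "a \<notin> J"
  shows "det_on (insert a J) M = (\<Sum>b\<in>insert a J. \<Sum>q | q permutes J.
     of_int (sign (Transposition.transpose a b \<circ> q)) * (\<Prod>i\<in>insert a J. M i ((Transposition.transpose a b \<circ> q) i)))"
  unfolding det_on_def by (rule sum_over_permutations_insert[OF assms])

lemma det_on_2:
  assumes "a \<noteq> b"
  shows "det_on {a, b} M = M a a * M b b - M a b * M b a"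
  using assms by (subst det_on_insert) (auto simp: sign_swap_id)

lemma det_on_3:
  assumes "a \<noteq> b" "a \<noteq> c" "b \<noteq> c"
  shows "det_on {a, b, c} M = M a a * (M b b * M c c - M b c * M c b)
    - M a b * (M b a * M c c - M b c * M c a) + M a c * (M b a * M c b - M b b * M c a)"
proof -
  \<comment> \<open>The two permutations of \<open>{b, c}\<close> must be known to differ to
    contribute two separate summands.\<close>
  have "Transposition.transpose b c \<noteq> id" using assms(3) by (metis id_apply transpose_apply_first)
  then show ?thesis
  using assms by (subst det_on_insert)
    (auto simp: permutes_doubleton_iff Collect_disj_eq sign_compose sign_swap_id permutation_swap_id Transposition.transpose_def algebra_simps)
qed

text \<open>Polynomial form of the graph conditions. Positivity of the product says that all arcs of
  the closed walk are present and fixes its parity: even for length four, odd for length six. The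
  indices \<open>k\<close>, \<open>k'\<close>, \<open>k''\<close> may coincide because the
  conditions are applied to every term of sums over all index tuples.\<close>

locale cycle_conditions =
  fixes m :: nat and A B :: "nat \<Rightarrow> nat \<Rightarrow> real"
  assumes nonneg: "\<lbrakk>i < 3; k < m\<rbrakk> \<Longrightarrow> 0 \<le> A i k * B k i"
    and cycle4: "\<lbrakk>a < 3; b < 3; a \<noteq> b; k < m; k' < m; 0 < A a k * B k b * A b k' * B k' a\<rbrakk>
      \<Longrightarrow> A a k * A b k' = A b k * A a k'"
    and cycle6: "\<lbrakk>a < 3; b < 3; c < 3; distinct [a, b, c]; k < m; k' < m; k'' < m;
        0 < A a k * B k b * A b k' * B k' c * A c k'' * B k'' a\<rbrakk>
      \<Longrightarrow> A a k * A b k' * A c k'' = A b k * A c k' * A a k''"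

text \<open>Labelling each pair by its complementary index turns the compound into the transpose of
  (tr M)I - M, up to conjugation by a diagonal sign matrix. Principal minors are unaffected by this,
  and the last one is det((tr M)I - M).\<close>

lemma principal_minors_add_compound2:
  "det_on {(0,1)} (add_compound2 M) = M 0 0 + M 1 1"
  "det_on {(0,2)} (add_compound2 M) = M 0 0 + M 2 2"
  "det_on {(1,2)} (add_compound2 M) = M 1 1 + M 2 2"
  "det_on {(0,1), (0,2)} (add_compound2 M) = minor2 M 1 2 + M 0 0 * tr3 M"
  "det_on {(0,1), (1,2)} (add_compound2 M) = minor2 M 0 2 + M 1 1 * tr3 M"
  "det_on {(0,2), (1,2)} (add_compound2 M) = minor2 M 0 1 + M 2 2 * tr3 M"
  "det_on {(0,1), (0,2), (1,2)} (add_compound2 M) =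
    tr3 M * (minor2 M 0 1 + minor2 M 0 2 + minor2 M 1 2) - det3 M"
  by (simp_all add: det_on_singleton det_on_2 det_on_3 add_compound2_def minor2_def tr3_def det3_def algebra_simps)

text \<open>If p and q differ, the last two hypotheses make the cross terms nonpositive. In the
  applications the cross terms are exactly the products along closed walks in
  \<open>cycle_conditions\<close>.\<close>

lemma diff_mult_diff_nonneg:
  fixes p q p' q' :: real
  assumes "0 \<le> p * p'" "0 \<le> q * q'" "0 < p * q' \<Longrightarrow> p = q" "0 < q * p' \<Longrightarrow> p = q"
  shows "0 \<le> (p - q) * (p' - q')"
proof (cases "p = q")
  case False
  then have "p * q' \<le> 0" "q * p' \<le> 0" using assms(3,4) by (meson not_less)+
  then show ?thesis using assms(1,2) by (simp add: algebra_simps)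
qed simp

lemma sum_product3:
  fixes f g h :: "nat \<Rightarrow> real"
  shows "(\<Sum>k<m. f k) * ((\<Sum>k<m. g k) * (\<Sum>k<m. h k)) =
    (\<Sum>k<m. \<Sum>k'<m. \<Sum>k''<m. f k * (g k' * h k''))"
  by (subst sum_product, subst sum_distrib_right) (simp only: sum_distrib_left)

section \<open>Minors and eigenvalues of AB under the cycle conditions\<close>

context cycle_conditions
begin

abbreviation "M \<equiv> mat_mult m A B"

lemma diag_nonneg: "i < 3 \<Longrightarrow> 0 \<le> M i i"
  by (auto simp: mat_mult_def intro!: sum_nonneg nonneg)

text \<open>This is the Cauchy-Binet formula, doubled so that it becomes a sum over ordered pairs
  \<open>(k, k')\<close> in which every term has the form of
  \<open>diff_mult_diff_nonneg\<close>.\<close>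

lemma minor2_nonneg:
  assumes "a < 3" "b < 3" "a \<noteq> b"
  shows "0 \<le> minor2 M a b"
proof -
  have "2 * minor2 M a b = M a a * M b b + M b b * M a a - M a b * M b a - M b a * M a b"
    by (simp add: minor2_def)
  also have "\<dots> = (\<Sum>k<m. \<Sum>k'<m. (A a k * A b k' - A b k * A a k') * (B k a * B k' b - B k b * B k' a))"
    unfolding mat_mult_def sum_product sum.distrib[symmetric] sum_subtractf[symmetric]
    by (intro sum.cong refl) (simp add: algebra_simps)
  also have "\<dots> \<ge> 0"
  proof (intro sum_nonneg diff_mult_diff_nonneg)
    fix k k' assume "k \<in> {..<m}" "k' \<in> {..<m}"
    then have k: "k < m" "k' < m" by auto
    show "0 \<le> A a k * A b k' * (B k a * B k' b)"
      using mult_nonneg_nonneg[OF nonneg[of a k] nonneg[of b k']] k assms by (simp add: ac_simps)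
    show "0 \<le> A b k * A a k' * (B k b * B k' a)"
      using mult_nonneg_nonneg[OF nonneg[of b k] nonneg[of a k']] k assms by (simp add: ac_simps)
    show "A a k * A b k' = A b k * A a k'" if "0 < A a k * A b k' * (B k b * B k' a)"
      by (rule cycle4) (use that k assms in \<open>simp_all add: ac_simps\<close>)
    show "A a k * A b k' = A b k * A a k'" if "0 < A b k * A a k' * (B k a * B k' b)"
      by (rule cycle4[symmetric]) (use that k assms in \<open>simp_all add: ac_simps\<close>)
  qed
  finally show ?thesis by simp
qed

lemma cyclic_products_le: "M 0 1 * M 1 2 * M 2 0 + M 0 2 * M 1 0 * M 2 1 \<le> 2 * (M 0 0 * M 1 1 * M 2 2)"
proof -
  let ?t = "\<lambda>k k' k''. (A 0 k * A 1 k' * A 2 k'' - A 1 k * A 2 k' * A 0 k'') *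
    (B k 0 * B k' 1 * B k'' 2 - B k 1 * B k' 2 * B k'' 0)"
  \<comment> \<open>The diagonal product is written twice, the second time cyclically rotated. With
    the factors in this order the four triple sums have the terms pp', qq', pq' and qp', which
    combine to (p - q)(p' - q').\<close>
  have "2 * (M 0 0 * M 1 1 * M 2 2) - (M 0 1 * M 1 2 * M 2 0 + M 0 2 * M 1 0 * M 2 1) =
    M 0 0 * (M 1 1 * M 2 2) + M 1 1 * (M 2 2 * M 0 0)
    - M 0 1 * (M 1 2 * M 2 0) - M 1 0 * (M 2 1 * M 0 2)"
    by simp
  also have "\<dots> = (\<Sum>k<m. \<Sum>k'<m. \<Sum>k''<m. ?t k k' k'')"
    unfolding mat_mult_def sum_product3 sum.distrib[symmetric] sum_subtractf[symmetric]
    by (intro sum.cong refl) (simp add: algebra_simps)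
  also have "\<dots> \<ge> 0"
  proof (intro sum_nonneg diff_mult_diff_nonneg)
    fix k k' k'' assume "k \<in> {..<m}" "k' \<in> {..<m}" "k'' \<in> {..<m}"
    then have k: "k < m" "k' < m" "k'' < m" by auto
    have "0 \<le> (A 0 k * B k 0) * ((A 1 k' * B k' 1) * (A 2 k'' * B k'' 2))"
      using k by (intro mult_nonneg_nonneg[OF nonneg mult_nonneg_nonneg[OF nonneg nonneg]]) simp_all
    then show "0 \<le> A 0 k * A 1 k' * A 2 k'' * (B k 0 * B k' 1 * B k'' 2)"
      by (simp only: ac_simps)
    have "0 \<le> (A 1 k * B k 1) * ((A 2 k' * B k' 2) * (A 0 k'' * B k'' 0))"
      using k by (intro mult_nonneg_nonneg[OF nonneg mult_nonneg_nonneg[OF nonneg nonneg]]) simp_all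
    then show "0 \<le> A 1 k * A 2 k' * A 0 k'' * (B k 1 * B k' 2 * B k'' 0)"
      by (simp only: ac_simps)
    show "A 0 k * A 1 k' * A 2 k'' = A 1 k * A 2 k' * A 0 k''"
      if "0 < A 0 k * A 1 k' * A 2 k'' * (B k 1 * B k' 2 * B k'' 0)"
    proof -
      have "0 < A 0 k * B k 1 * A 1 k' * B k' 2 * A 2 k'' * B k'' 0"
        using that by (simp only: ac_simps)
      from cycle6[OF _ _ _ _ k this] show ?thesis by simp
    qed
    show "A 0 k * A 1 k' * A 2 k'' = A 1 k * A 2 k' * A 0 k''"
      if "0 < A 1 k * A 2 k' * A 0 k'' * (B k 0 * B k' 1 * B k'' 2)"
    proof -
      \<comment> \<open>This cross term follows the S-indices in the order 1, 0, 2, so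
        \<open>k'\<close> and \<open>k''\<close> change places in the application of
        \<open>cycle6\<close>.\<close>
      have "0 < A 1 k * B k 0 * A 0 k'' * B k'' 2 * A 2 k' * B k' 1"
        using that by (simp only: ac_simps)
      from cycle6[OF _ _ _ _ k(1,3,2) this]
      have "A 1 k * A 0 k'' * A 2 k' = A 0 k * A 2 k'' * A 1 k'" by simp
      then show ?thesis by (simp only: ac_simps)
    qed
  qed
  finally show ?thesis by simp
qed

lemma tr3_nonneg: "0 \<le> tr3 M"
  using diag_nonneg[of 0] diag_nonneg[of 1] diag_nonneg[of 2] by (simp add: tr3_def)

text \<open>Each 2 x 2 minor is multiplied by its own two diagonal entries and by the third one. The
  products with the third entry, minus the determinant, leave only twice the diagonal product minus
  the two cyclic products.\<close>

lemma det3_le: "det3 M \<le> tr3 M * (minor2 M 0 1 + minor2 M 0 2 + minor2 M 1 2)"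
proof -
  have "tr3 M * (minor2 M 0 1 + minor2 M 0 2 + minor2 M 1 2) - det3 M =
    (M 0 0 + M 1 1) * minor2 M 0 1 + (M 0 0 + M 2 2) * minor2 M 0 2 + (M 1 1 + M 2 2) * minor2 M 1 2
    + (2 * (M 0 0 * M 1 1 * M 2 2) - (M 0 1 * M 1 2 * M 2 0 + M 0 2 * M 1 0 * M 2 1))"
    by (simp add: tr3_def minor2_def det3_def algebra_simps)
  also have "\<dots> \<ge> 0"
    using cyclic_products_le diag_nonneg[of 0] diag_nonneg[of 1] diag_nonneg[of 2]
      minor2_nonneg[of 0 1] minor2_nonneg[of 0 2] minor2_nonneg[of 1 2]
    by (intro add_nonneg_nonneg mult_nonneg_nonneg) simp_all
  finally show ?thesis by simp
qed

lemma P0_matrix_add_compound2: "P0_matrix (pairs 3) (add_compound2 M)"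
  unfolding P0_matrix_def
proof (intro allI impI)
  fix J :: "(nat \<times> nat) set" assume "J \<subseteq> pairs 3"
  then have "J \<in> Pow {(0,1), (0,2), (1,2)}" by (simp add: pairs_3)
  then have J: "J = {} \<or> J = {(0,1)} \<or> J = {(0,2)} \<or> J = {(1,2)} \<or> J = {(0,1), (0,2)} \<or>
    J = {(0,1), (1,2)} \<or> J = {(0,2), (1,2)} \<or> J = {(0,1), (0,2), (1,2)}"
    by (simp only: Pow_insert Pow_empty image_Un image_insert image_empty insert_iff Un_iff empty_iff)
      (elim disjE FalseE; simp only: simp_thms)
  have "0 \<le> M 0 0" "0 \<le> M 1 1" "0 \<le> M 2 2" "0 \<le> minor2 M 0 1" "0 \<le> minor2 M 0 2" "0 \<le> minor2 M 1 2"
    by (simp_all add: diag_nonneg minor2_nonneg)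
  then show "0 \<le> det_on J (add_compound2 M)"
    using J tr3_nonneg det3_le by (elim disjE) (simp_all add: principal_minors_add_compound2 del: One_nat_def)
qed

lemma nonreal_eigenvalue_Re_nonneg:
  assumes "is_eigenvalue 3 M z" "Im z \<noteq> 0"
  shows "0 \<le> Re z"
  using nonreal_cubic_root_Re_nonneg[OF is_eigenvalue_3_root[OF assms(1)] assms(2) tr3_nonneg _ det3_le]
    minor2_nonneg[of 0 1] minor2_nonneg[of 0 2] minor2_nonneg[of 1 2] by simp

end

subsection \<open>The graph of the second additive compound\<close>

text \<open>The pair complementary to \<open>x\<close> in \<open>{0, 1, 2}\<close>.\<close>

definition opp :: "nat \<Rightarrow> nat \<times> nat" where
  "opp x = (if x = 0 then (1, 2) else if x = 1 then (0, 2) else (0, 1))"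

text \<open>For distinct z and y, this is the sign from putting e_z wedge e_y into increasing order,
  which is the sign carried by the entries of \<open>Lbar\<close> and \<open>Lunder\<close>.\<close>

definition eps :: "nat \<Rightarrow> nat \<Rightarrow> real" where
  "eps z y = (if z < y then 1 else - 1)"

lemma less_3_cases: "(x::nat) < 3 \<longleftrightarrow> x = 0 \<or> x = 1 \<or> x = 2"
  by auto

lemma eps_swap: "x \<noteq> y \<Longrightarrow> eps x y = - eps y x"
  by (auto simp: eps_def)

lemma eps_square [simp]: "eps x y * eps x y = 1" "eps x y * (eps x y * c) = c" "\<bar>eps x y\<bar> = 1"
  by (auto simp: eps_def)

lemma pairs_3_opp: "pairs 3 = opp ` {..<3}"
proof -
  have "{..<3::nat} = {0, 1, 2}" by auto
  then show ?thesis by (auto simp: pairs_3 opp_def)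
qed

lemma opp_inject: "x < 3 \<Longrightarrow> y < 3 \<Longrightarrow> opp x = opp y \<longleftrightarrow> x = y"
  unfolding less_3_cases by (elim disjE) (simp_all add: opp_def)

text \<open>The pair \<open>opp x\<close> consists of y and z, so removing z leaves the index y.
  Indexing pairs by complements makes \<open>opp z\<close> the only pair that \<open>(k, z)\<close>
  cannot be adjacent to.\<close>

lemma Lbar_opp:
  assumes "x < 3" "y < 3" "z < 3" "distinct [x, y, z]"
  shows "Lbar A (opp x) (k, z) = eps z y * A y k" and "Lunder B (k, z) (opp x) = eps z y * B k y"
  using assms unfolding less_3_cases by (elim disjE; simp add: Lbar_def Lunder_def opp_def eps_def)+

lemma Lbar_opp_same: "x < 3 \<Longrightarrow> Lbar A (opp x) (k, x) = 0" "x < 3 \<Longrightarrow> Lunder B (k, x) (opp x) = 0"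
  unfolding less_3_cases by (elim disjE; simp add: Lbar_def Lunder_def opp_def)+

fun R_end :: "('s, 'r) dedge \<Rightarrow> 'r" where
  "R_end (EU s r) = r" | "R_end (EA s r) = r" | "R_end (EB s r) = r"

lemma R_end_edge_between [simp]: "R_end (edge_between G s r) = r"
  by (simp add: edge_between_def)

section \<open>Cycles of the compound graph and their projections\<close>

context cycle_conditions
begin

abbreviation "G2 \<equiv> DSR2_graph 3 m A B"

lemma sign_compatible_G2: "sign_compatible G2"
  unfolding sign_compatible_def
proof (intro ballI)
  fix s r assume "s \<in> Sset G2" "r \<in> Rset G2"
  then obtain x k z where eq: "s = opp x" "r = (k, z)" and lt: "x < 3" "z < 3" "k < m"
    by (auto simp: DSR2_graph_def pairs_3_opp)
  show "0 \<le> Amat G2 s r * Bmat G2 r s"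
  proof (cases "x = z")
    case True
    then show ?thesis using lt by (simp add: DSR2_graph_def eq Lbar_opp_same)
  next
    case False
    \<comment> \<open>The third index, since 0 + 1 + 2 = 3.\<close>
    define y where "y = 3 - x - z"
    have y: "y < 3" "distinct [x, y, z]"
      using lt(1,2) False unfolding less_3_cases y_def by (elim disjE; simp)+
    then show ?thesis using nonneg[of y k] lt
      by (simp add: DSR2_graph_def eq Lbar_opp[OF lt(1) y(1) lt(2) y(2)] ac_simps)
  qed
qed

text \<open>An R-vertex lying between \<open>opp x\<close> and \<open>opp y\<close> must have the
  third index as its second component. This determines the second components of all R-vertices on
  the cycle.\<close>

lemma G2_cycle_cases:
  assumes "is_cycle G2 W"
  obtains (len4) at_S x y z k k' where "x < 3" "y < 3" "z < 3" "distinct [x, y, z]" "k < m" "k' < m"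
      "W = cycle4 G2 at_S (opp x) (k, z) (opp y) (k', z)"
    | (len6) at_S x y z k k' k'' where "x < 3" "y < 3" "z < 3" "distinct [x, y, z]"
      "k < m" "k' < m" "k'' < m"
      "W = cycle6 G2 at_S (opp x) (k, z) (opp y) (k', x) (opp z) (k'', y)"
proof -
  have S: "finite (Sset G2)" "card (Sset G2) \<le> 3"
    by (auto simp: DSR2_graph_def pairs_3 card_insert_if)
  have nadj: "Amat G2 (opp x) (k, x) = 0" "Bmat G2 (k, x) (opp x) = 0" if "x < 3" for x k
    using that by (auto simp: DSR2_graph_def Lbar_opp_same)
  have third: "l = z" if "x < 3" "y < 3" "z < 3" "distinct [x, y, z]" "l < 3" "l \<noteq> x" "l \<noteq> y" for x y z l :: nat
    using that unfolding less_3_cases by (elim disjE) simp_all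
  show thesis
  proof (cases rule: cycle_cases[OF sign_compatible_G2 S assms])
    case (1 at_S s r s' r')
    note c = assms[unfolded 1 is_cycle_cycle4[OF sign_compatible_G2]]
    obtain x where x: "s = opp x" "x < 3" using c by (auto simp: DSR2_graph_def pairs_3_opp)
    obtain y where y: "s' = opp y" "y < 3" using c by (auto simp: DSR2_graph_def pairs_3_opp)
    obtain k l where r: "r = (k, l)" "k < m" "l < 3" using c by (auto simp: DSR2_graph_def)
    obtain k' l' where r': "r' = (k', l')" "k' < m" "l' < 3" using c by (auto simp: DSR2_graph_def)
    note eq = x(1) y(1) r(1) r'(1) and lt = x(2) y(2) r(2,3) r'(2,3)
    have "x \<noteq> y" using c eq by auto
    have l: "l \<noteq> x" "l \<noteq> y" "l' \<noteq> x" "l' \<noteq> y"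
      using c lt unfolding eq by (auto simp: nadj)
    have d: "distinct [x, y, l]" using l \<open>x \<noteq> y\<close> by auto
    have "l' = l" by (rule third[OF x(2) y(2) r(3) d r'(3) l(3,4)])
    then have "W = cycle4 G2 at_S (opp x) (k, l) (opp y) (k', l)" using 1 eq by simp
    then show thesis by (rule len4[OF x(2) y(2) r(3) d r(2) r'(2)])
  next
    case (2 at_S s r s' r' s'' r'')
    note c = assms[unfolded 2 is_cycle_cycle6[OF sign_compatible_G2]]
    obtain x where x: "s = opp x" "x < 3" using c by (auto simp: DSR2_graph_def pairs_3_opp)
    obtain y where y: "s' = opp y" "y < 3" using c by (auto simp: DSR2_graph_def pairs_3_opp)
    obtain z where z: "s'' = opp z" "z < 3" using c by (auto simp: DSR2_graph_def pairs_3_opp)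
    obtain k l where r: "r = (k, l)" "k < m" "l < 3" using c by (auto simp: DSR2_graph_def)
    obtain k' l' where r': "r' = (k', l')" "k' < m" "l' < 3" using c by (auto simp: DSR2_graph_def)
    obtain k'' l'' where r'': "r'' = (k'', l'')" "k'' < m" "l'' < 3"
      using c by (auto simp: DSR2_graph_def)
    note eq = x(1) y(1) z(1) r(1) r'(1) r''(1) and lt = x(2) y(2) z(2) r(2,3) r'(2,3) r''(2,3)
    have d: "distinct [x, y, z]" using c eq by auto
    have l: "l \<noteq> x" "l \<noteq> y" "l' \<noteq> y" "l' \<noteq> z" "l'' \<noteq> z" "l'' \<noteq> x"
      using c lt unfolding eq by (auto simp: nadj)
    have d': "distinct [y, z, x]" "distinct [z, x, y]" using d by auto
    have "l = z" by (rule third[OF x(2) y(2) z(2) d r(3) l(1,2)])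
    moreover have "l' = x" by (rule third[OF y(2) z(2) x(2) d'(1) r'(3) l(3,4)])
    moreover have "l'' = y" by (rule third[OF z(2) x(2) y(2) d'(2) r''(3) l(5,6)])
    ultimately have "W = cycle6 G2 at_S (opp x) (k, z) (opp y) (k', x) (opp z) (k'', y)"
      using 2 eq by simp
    then show thesis by (rule len6[OF x(2) y(2) z(2) d r(2) r'(2) r''(2)])
  qed
qed

text \<open>For length four the signs \<open>eps\<close> cancel in pairs. For length six they form
  three products of the shape \<open>eps x y * eps y x = - 1\<close>, so an e-cycle projects to a
  walk with positive product, as \<open>cycle6\<close> requires. The label equation sees the signs
  only through absolute values.\<close>

lemma G2_e_cycle_s_cycle:
  assumes "e_cycle G2 W"
  shows "s_cycle G2 W"
proof -
  have cyc: "is_cycle G2 W" and par: "walk_parity G2 W = 1" using assms by (auto simp: e_cycle_def)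
  have mats: "Amat G2 = Lbar A" "Bmat G2 = Lunder B" by (auto simp: DSR2_graph_def)
  from cyc have "s_walk G2 W"
  proof (cases rule: G2_cycle_cases)
    case (len4 at_S x y z k k')
    note L = Lbar_opp[of x y z] Lbar_opp[of y x z]
    have "sgn (A x k * B k y * A y k' * B k' x) = 1"
      using par len4(1-4) unfolding len4(7) walk_parity_cycle4[OF sign_compatible_G2 cyc[unfolded len4(7)]] mats
      by (simp add: L ac_simps)
    then have "A x k * A y k' = A y k * A x k'"
      using cycle4[of x y k k'] len4 by (simp add: sgn_1_pos)
    moreover have "Lbar A (opp y) (k, z) * Lbar A (opp x) (k', z) =
        (eps z x * eps z y) * (A x k * A y k')"
      "Lbar A (opp x) (k, z) * Lbar A (opp y) (k', z) = (eps z x * eps z y) * (A y k * A x k')"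
      using len4(1-4) by (simp_all add: L)
    ultimately show ?thesis
      unfolding len4(7) s_walk_cycle4[OF sign_compatible_G2 cyc[unfolded len4(7)]] mats
      by (simp only:)
  next
    case (len6 at_S x y z k k' k'')
    note L = Lbar_opp[of x y z] Lbar_opp[of y x z] Lbar_opp[of y z x] Lbar_opp[of z y x]
      Lbar_opp[of z x y] Lbar_opp[of x z y]
    have "sgn (A x k * B k y * A y k' * B k' z * A z k'' * B k'' x) = 1"
      using par len6(1-4) unfolding len6(8) walk_parity_cycle6[OF sign_compatible_G2 cyc[unfolded len6(8)]] mats
      by (simp add: L eps_swap[of y x] eps_swap[of z x] eps_swap[of z y] ac_simps)
    then have "A x k * A y k' * A z k'' = A y k * A z k' * A x k''"
      using cycle6[of x y z k k' k''] len6 by (simp add: sgn_1_pos)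
    moreover have "Lbar A (opp y) (k, z) * Lbar A (opp x) (k'', y) * Lbar A (opp z) (k', x) =
        (eps z x * eps y z * eps x y) * (A x k * A y k' * A z k'')"
      using len6(1-4) by (simp add: L)
    moreover have "Lbar A (opp x) (k, z) * Lbar A (opp z) (k'', y) * Lbar A (opp y) (k', x) =
        - (eps z x * eps y z * eps x y) * (A y k * A z k' * A x k'')"
      using len6(1-4) by (simp add: L eps_swap[of x z] eps_swap[of z y] eps_swap[of y x])
    ultimately show ?thesis
      unfolding len6(8) s_walk_cycle6[OF sign_compatible_G2 cyc[unfolded len6(8)]] mats
      by (simp only: mult_minus_left abs_minus_cancel)
  qed
  with cyc show ?thesis by (simp add: s_cycle_def)
qed

section \<open>Intersections of two cycles\<close>

lemma G2_cycle_edge: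
  assumes "is_cycle G2 W" "e \<in> set (snd W)"
  obtains s k l where "e = edge_between G2 s (k, l)" "s \<in> opp ` ({..<3} - {l})" "l < 3"
proof -
  from assms show thesis
    by (cases rule: G2_cycle_cases) (auto simp: cycle4_def cycle6_def Let_def split: if_splits intro!: that)
qed

text \<open>An R-vertex has at most two neighbours, and a cycle through it enters from one and
  leaves to the other.\<close>

lemma G2_cycle_edges_at_R:
  assumes "is_cycle G2 W" "edge_between G2 s (k, l) \<in> set (snd W)" "s' \<in> opp ` ({..<3} - {l})"
  shows "edge_between G2 s' (k, l) \<in> set (snd W)"
proof -
  obtain x' where x': "s' = opp x'" "x' < 3" "x' \<noteq> l" using assms(3) by auto
  have third: "x' = x \<or> x' = y" if "x < 3" "y < 3" "z < 3" "distinct [x, y, z]" "x' \<noteq> z" for x y z :: nat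
    using that x'(2) unfolding less_3_cases by (elim disjE) simp_all
  from assms(1) show ?thesis
  proof (cases rule: G2_cycle_cases)
    case (len4 at_S x y z k1 k2)
    have "l = z" using assms(2) by (auto simp: len4(7) cycle4_def Let_def split: if_splits)
    then have "x' = x \<or> x' = y" using third[of x y z] len4 x' by auto
    then show ?thesis using assms(2) x' by (auto simp: len4(7) cycle4_def Let_def)
  next
    case (len6 at_S x y z k1 k2 k3)
    have "(k, l) = (k1, z) \<or> (k, l) = (k2, x) \<or> (k, l) = (k3, y)"
      using assms(2) by (auto simp: len6(8) cycle6_def Let_def split: if_splits)
    then show ?thesis using x' third[of x y z] third[of y z x] third[of z x y] len6(1-4)
      by (auto simp: len6(8) cycle6_def Let_def)
  qed
qed

text \<open>The edges of a component are grouped by their R-vertex. If two cycles share one edge at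
  an R-vertex, they share both of them, so every group has exactly two elements.\<close>

lemma G2_component_length_even:
  assumes C: "is_cycle G2 C" and D: "is_cycle G2 D"
  shows "even (component_length C D u)"
proof -
  define X where "X = {e \<in> common_edges C D. \<exists>x \<in> endpoints e. (u, x) \<in> (inter_adj C D)\<^sup>*}"
  have fin: "finite X" by (simp add: X_def common_edges_def)
  have "card {e \<in> X. R_end e = r} = 2" if rX: "r \<in> R_end ` X" for r
  proof -
    obtain e where e: "e \<in> X" "R_end e = r" using rX by auto
    then have eC: "e \<in> set (snd C)" "e \<in> set (snd D)" by (auto simp: X_def common_edges_def)
    obtain s k l where eq: "e = edge_between G2 s (k, l)" and l: "l < 3"
      by (rule G2_cycle_edge[OF C eC(1)])
    have r: "r = (k, l)" using e eq by simp
    have adj: "(SV s, RV r) \<in> inter_adj C D" "(RV r, SV s) \<in> inter_adj C D"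
      using eC by (auto simp: inter_adj_def common_edges_def eq r insert_commute intro!: bexI[of _ e])
    \<comment> \<open>Whichever endpoint of \<open>e\<close> is reachable from \<open>u\<close>,
      crossing \<open>e\<close> if necessary reaches the R-vertex, so the other edge there lies in
      the same component.\<close>
    then have reach: "(u, RV r) \<in> (inter_adj C D)\<^sup>*"
      using e by (auto simp: X_def eq r intro: rtrancl_into_rtrancl)
    have "{e \<in> X. R_end e = r} = (\<lambda>s. edge_between G2 s r) ` opp ` ({..<3} - {l})"
    proof (intro equalityI subsetI)
      fix f assume "f \<in> {e \<in> X. R_end e = r}"
      then have f: "f \<in> set (snd C)" "R_end f = r" by (auto simp: X_def common_edges_def)
      obtain s' k' l' where "f = edge_between G2 s' (k', l')" "s' \<in> opp ` ({..<3} - {l'})"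
        by (rule G2_cycle_edge[OF C f(1)])
      then show "f \<in> (\<lambda>s. edge_between G2 s r) ` opp ` ({..<3} - {l})"
        using f(2) r by (intro image_eqI[of _ _ s']) simp_all
    next
      fix f assume "f \<in> (\<lambda>s. edge_between G2 s r) ` opp ` ({..<3} - {l})"
      then obtain s' where s': "s' \<in> opp ` ({..<3} - {l})" "f = edge_between G2 s' r" by auto
      have "f \<in> common_edges C D"
        using G2_cycle_edges_at_R[OF C _ s'(1)] G2_cycle_edges_at_R[OF D _ s'(1)] eC
        by (simp add: common_edges_def eq r s')
      then show "f \<in> {e \<in> X. R_end e = r}" using reach by (auto simp: X_def s')
    qed
    moreover have "inj_on opp ({..<3} - {l})" by (auto simp: inj_on_def opp_inject)
    ultimately show ?thesis using l
      by (simp add: card_image inj_on_def)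
  qed
  then have "(\<Sum>r\<in>R_end ` X. card {e \<in> X. R_end e = r}) = (\<Sum>r\<in>R_end ` X. 2)" by simp
  moreover have "card X = (\<Sum>r\<in>R_end ` X. card {e \<in> X. R_end e = r})"
    using sum.image_gen[OF fin, of "\<lambda>_. 1::nat" R_end] by simp
  ultimately have "even (card X)" by simp
  then show ?thesis by (simp add: component_length_def X_def)
qed

text \<open>Each cycle visits at least two of the three S-vertices. A common vertex is needed
  because the condition on components in \<open>odd_intersection\<close> holds vacuously for
  disjoint cycles.\<close>

lemma G2_cycles_meet:
  assumes C: "is_cycle G2 C" and D: "is_cycle G2 D"
  shows "common_verts C D \<noteq> {}"
proof -
  have two: "\<exists>x y. x < 3 \<and> y < 3 \<and> x \<noteq> y \<and> SV (opp x) \<in> set (fst W) \<and> SV (opp y) \<in> set (fst W)"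
    if "is_cycle G2 W" for W
    using that
  proof (cases rule: G2_cycle_cases)
    case (len4 at_S x y z k k')
    then show ?thesis by (intro exI[of _ x] exI[of _ y]) (auto simp: cycle4_def Let_def)
  next
    case (len6 at_S x y z k k' k'')
    then show ?thesis by (intro exI[of _ x] exI[of _ y]) (auto simp: cycle6_def Let_def)
  qed
  obtain x y x' y' where xy: "x < 3" "y < 3" "x \<noteq> y" "x' < 3" "y' < 3" "x' \<noteq> y'"
    and "SV (opp x) \<in> set (fst C)" "SV (opp y) \<in> set (fst C)"
    and "SV (opp x') \<in> set (fst D)" "SV (opp y') \<in> set (fst D)"
    using two[OF C] two[OF D] by blast
  moreover have "x = x' \<or> x = y' \<or> y = x' \<or> y = y'" using xy unfolding less_3_cases
    by (elim disjE) simp_all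
  ultimately show ?thesis by (auto simp: common_verts_def)
qed

lemma odd_star_G2: "odd_star G2"
proof -
  have False if "e_cycle G2 C" "e_cycle G2 D" "odd_intersection G2 C D" for C D
  proof -
    have cyc: "is_cycle G2 C" "is_cycle G2 D" using that by (auto simp: e_cycle_def)
    obtain u where "u \<in> common_verts C D" using G2_cycles_meet[OF cyc] by auto
    then show False using that(3) G2_component_length_even[OF cyc, of u]
      by (auto simp: odd_intersection_def)
  qed
  then show ?thesis using G2_e_cycle_s_cycle by (auto simp: odd_star_def)
qed

end

section \<open>From the graph hypotheses to the polynomial cycle conditions\<close>

theorem theorem6p1:
  fixes m :: nat and A B C :: "nat \<Rightarrow> nat \<Rightarrow> real"
  assumes "m \<ge> 1"
    and "A \<in> qual_class0 3 m C"
    and "mat_transpose B \<in> qual_class0 3 m C"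
    and "\<forall>W. e_cycle (DSR_graph 3 m A B) W \<and> walk_len W = 4 \<longrightarrow> s_cycle (DSR_graph 3 m A B) W"
    and "\<forall>W. o_cycle (DSR_graph 3 m A B) W \<and> walk_len W = 6 \<longrightarrow> s_cycle (DSR_graph 3 m A B) W"
  shows "odd_star (DSR2_graph 3 m A B)
    \<and> P0_matrix (pairs 3) (add_compound2 (mat_mult m A B))
    \<and> \<not> (\<exists>z. is_eigenvalue 3 (mat_mult m A B) z \<and> Im z \<noteq> 0 \<and> Re z < 0)"
proof -
  let ?G = "DSR_graph 3 m A B"
  have mats: "Amat ?G = A" "Bmat ?G = B" "Sset ?G = {..<3}" "Rset ?G = {..<m}"
    by (auto simp: DSR_graph_def)
  have nonneg: "0 \<le> A i k * B k i" if "i < 3" "k < m" for i k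
    using qual_class0_mult_nonneg[OF assms(2,3) that] .
  then have comp: "sign_compatible ?G" by (auto simp: sign_compatible_def mats)
  \<comment> \<open>The s-cycle condition only gives equal moduli. With \<open>q'\<close> the
    monomial in B belonging to q, the case p = -q would give \<open>p * q' \<le> 0\<close>.\<close>
  have abs_eq: "p = q" if "\<bar>p\<bar> = \<bar>q\<bar>" "0 < p * q'" "0 \<le> q * q'" for p q q' :: real
    using that by (auto simp: abs_eq_iff)
  have h4: "A a k * A b k' = A b k * A a k'"
    if "a < 3" "b < 3" "a \<noteq> b" "k < m" "k' < m" "0 < A a k * B k b * A b k' * B k' a" for a b k k'
  proof (cases "k = k'")
    case False
    \<comment> \<open>The entry \<open>B k b\<close> is the arc from S_b to R_k and
      \<open>A a k\<close> the arc from R_k to S_a, so the walk starts at b and not at a.\<close>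
    let ?W = "cycle4 ?G True b k a k'"
    have cyc: "is_cycle ?G ?W"
      using that False unfolding is_cycle_cycle4[OF comp] mats by auto
    moreover have "walk_parity ?G ?W = 1"
      using that unfolding walk_parity_cycle4[OF comp cyc] mats by simp
    ultimately have "s_walk ?G ?W" using assms(4)[rule_format, of ?W] by (simp add: e_cycle_def s_cycle_def)
    then have "\<bar>A a k * A b k'\<bar> = \<bar>A b k * A a k'\<bar>"
      unfolding s_walk_cycle4[OF comp cyc] mats .
    then show ?thesis
      using that mult_nonneg_nonneg[OF nonneg[of b k] nonneg[of a k']]
      by (elim abs_eq[where q' = "B k b * B k' a"]) (simp_all add: ac_simps)
  qed simp
  have h6: "A a k * A b k' * A c k'' = A b k * A c k' * A a k''"
    if "a < 3" "b < 3" "c < 3" "distinct [a, b, c]" "k < m" "k' < m" "k'' < m"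
      and pos: "0 < A a k * B k b * A b k' * B k' c * A c k'' * B k'' a" for a b c k k' k''
  proof -
    \<comment> \<open>If two R-vertices coincide, the walk of length six contains the detour
      \<open>A b k * B k b\<close>, which is nonnegative. Deleting it leaves a closed walk of length
      four through a and c, to which \<open>h4\<close> applies. The three possible coincidences are
      rotations of this one.\<close>
    have coincide: "A a k * A b k * A c k'' = A b k * A c k * A a k''"
      if "a < 3" "b < 3" "c < 3" "a \<noteq> c" "k < m" "k'' < m"
        and pos: "0 < A a k * B k b * A b k * B k c * A c k'' * B k'' a" for a b c k k''
    proof -
      have "0 < (A b k * B k b) * (A a k * B k c * A c k'' * B k'' a)"
        using pos by (simp add: ac_simps)
      then have "0 < A a k * B k c * A c k'' * B k'' a"
        using nonneg[of b k] that by (simp only: zero_less_mult_iff) auto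
      then show ?thesis using h4[of a c k k''] that by simp
    qed
    consider "k' = k" | "k'' = k'" | "k = k''" | "distinct [k, k', k'']" by auto
    then show ?thesis
    proof cases
      case 1
      then show ?thesis using coincide[of a b c k k''] that by auto
    next
      case 2
      then show ?thesis using coincide[of b c a k' k] that by (simp add: ac_simps)
    next
      case 3
      then show ?thesis using coincide[of c a b k k'] that by (simp add: ac_simps)
    next
      case 4
      \<comment> \<open>Following the arcs from S_b leads through R_k to S_a and from there through
        \<open>k''\<close> to S_c, hence \<open>k''\<close> precedes \<open>k'\<close>.\<close>
      let ?W = "cycle6 ?G True b k a k'' c k'"
      have cyc: "is_cycle ?G ?W"
        using that 4 unfolding is_cycle_cycle6[OF comp] mats by auto
      moreover have "walk_parity ?G ?W = - 1"
        using pos unfolding walk_parity_cycle6[OF comp cyc] mats by (simp add: ac_simps)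
      ultimately have "s_walk ?G ?W" using assms(5)[rule_format, of ?W] by (simp add: o_cycle_def s_cycle_def)
      then have "\<bar>A a k * A b k' * A c k''\<bar> = \<bar>A b k * A c k' * A a k''\<bar>"
        unfolding s_walk_cycle6[OF comp cyc] mats .
      then show ?thesis
        using that mult_nonneg_nonneg[OF nonneg[of b k] mult_nonneg_nonneg[OF nonneg[of c k'] nonneg[of a k'']]]
        by (elim abs_eq[where q' = "B k b * B k' c * B k'' a"]) (simp_all add: ac_simps)
    qed
  qed
  interpret cycle_conditions m A B
    by unfold_locales (use nonneg h4 h6 in blast)+
  show ?thesis
    using odd_star_G2 P0_matrix_add_compound2 nonreal_eigenvalue_Re_nonneg
    by (meson not_less)
qed

end
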